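(* There exist single-shot graphs $G_1$ and $G_2$ (that is, $\alpha(G_1)=\Theta(G_1)$ and $\alpha(G_2)=\Theta(G_2)$) such that $$\Theta(G_1\boxtimes G_2) > \Theta(G_1)\,\Theta(G_2)\qquad\text{and}\qquad \Theta(G_1+G_2) > \Theta(G_1)+\Theta(G_2).$$ It is even possible to choose such $G_1,G_2$ with the additional property $\alpha(G_2)=\vartheta(G_2)$.
   Context: A graph is a finite undirected simple graph without isolated vertices; $u\sim v$ denotes adjacency. $G_1+G_2$ is the disjoint union of graphs. The strong product $G_1\boxtimes G_2$ has vertex set $V(G_1)\times V(G_2)$, and two distinct vertices $(u_1,u_2),(v_1,v_2)$ are adjacent iff for each $i\in\{1,2\}$ either $u_i=v_i$ or $u_i\sim v_i$. $G^{\boxtimes n}$ is the $n$-fold strong product of $G$ with itself. $\alpha(G)$ is the independence number (largest cardinality of a set of pairwise non-adjacent vertices). The Shannon capacity is $\Theta(G)=\lim_{n\to\infty}\sqrt[n]{\alpha(G^{\boxtimes n})}$. An orthonormal labeling of $G$ assigns to each $v\in V(G)$ a unit vector $|\psi_v\rangle\in\mathbb{R}^{|V(G)|}$ such that $u\neq v$, $u\not\sim v$ implies $\langle\psi_u|\psi_v\rangle=0$. The Lovász number is $\vartheta(G)=\min_{|\Psi\rangle,|\psi_v\rangle}\max_{v\in V(G)}\frac{1}{|\langle\Psi|\psi_v\rangle|^2}$, with $|\Psi\rangle$ ranging over unit vectors in $\mathbb{R}^{|V(G)|}$ and $(|\psi_v\rangle)_v$ over orthonormal labelings of $G$. A graph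 $G$ is called single-shot if $\alpha(G)=\Theta(G)$. *)

theory Defs
  imports
    Complex_Main
    "HOL-Library.Extended_Real"
    "Graph_Theory.Pair_Digraph"
    "Jordan_Normal_Form.Matrix"
begin

text \<open>
  Undirected graphs are represented by symmetric arc sets: \<^locale>\<open>pair_graph\<close> says finite,
  well-formed, symmetric and loop-free, and \<open>(u, v) \<in> parcs G\<close> is adjacency.
\<close>

definition simple_graph :: "'a pair_pre_digraph \<Rightarrow> bool" where
  "simple_graph G \<longleftrightarrow> pair_graph G \<and> (\<forall>v \<in> pverts G. \<exists>u. (v, u) \<in> parcs G)"

definition adj_or_eq :: "'a pair_pre_digraph \<Rightarrow> 'a \<Rightarrow> 'a \<Rightarrow> bool" where
  "adj_or_eq G u v \<longleftrightarrow> u = v \<or> (u, v) \<in> parcs G"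

definition disjoint_union ::
    "'a pair_pre_digraph \<Rightarrow> 'b pair_pre_digraph \<Rightarrow> ('a + 'b) pair_pre_digraph" where
  "disjoint_union G H =
     \<lparr> pverts = pverts G <+> pverts H,
       parcs = map_prod Inl Inl ` parcs G \<union> map_prod Inr Inr ` parcs H \<rparr>"

definition strong_product ::
    "'a pair_pre_digraph \<Rightarrow> 'b pair_pre_digraph \<Rightarrow> ('a \<times> 'b) pair_pre_digraph" where
  "strong_product G H =
     \<lparr> pverts = pverts G \<times> pverts H,
       parcs = {(u, v). u \<in> pverts G \<times> pverts H \<and> v \<in> pverts G \<times> pverts H \<and> u \<noteq> v \<and>
                  adj_or_eq G (fst u) (fst v) \<and> adj_or_eq H (snd u) (snd v)} \<rparr>"

text \<open>
  Vertices of the \<open>n\<close>-fold strong product are lists of length \<open>n\<close>; \<open>strong_power_Suc\<close> below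
  shows that this is the iterated binary product up to the relabelling \<open>(u, us) \<mapsto> u # us\<close>.
\<close>

definition strong_power :: "'a pair_pre_digraph \<Rightarrow> nat \<Rightarrow> 'a list pair_pre_digraph" where
  "strong_power G n =
     (let V = {us. length us = n \<and> set us \<subseteq> pverts G} in
      \<lparr> pverts = V,
        parcs = {(us, vs). us \<in> V \<and> vs \<in> V \<and> us \<noteq> vs \<and> list_all2 (adj_or_eq G) us vs} \<rparr>)"

lemma strong_power_0: "strong_power G 0 = \<lparr> pverts = {[]}, parcs = {} \<rparr>"
  by (auto simp: strong_power_def)

lemma strong_power_Suc:
  fixes G :: "'a pair_pre_digraph"
  defines "c \<equiv> \<lambda>(u, us). u # us"
  defines "P \<equiv> \<lambda>n. strong_product G (strong_power G n)"
  shows "strong_power G (Suc n) =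
           \<lparr> pverts = c ` pverts (P n), parcs = map_prod c c ` parcs (P n) \<rparr>"
proof -
  have V: "{us. length us = Suc n \<and> set us \<subseteq> pverts G} = c ` pverts (P n)"
    by (force simp: c_def P_def strong_power_def strong_product_def length_Suc_conv image_iff)
  have E: "(us, vs) \<in> parcs (strong_power G (Suc n)) \<longleftrightarrow> (us, vs) \<in> map_prod c c ` parcs (P n)"
    for us vs
    by (cases us; cases vs)
      (auto simp: c_def P_def strong_power_def strong_product_def image_iff adj_or_eq_def
        intro: list.rel_refl)
  have "pverts (strong_power G (Suc n)) = c ` pverts (P n)"
    using V by (simp add: strong_power_def)
  moreover have "parcs (strong_power G (Suc n)) = map_prod c c ` parcs (P n)"
    using E by auto
  ultimately show ?thesis
    by simp
qed

definition independent_set :: "'a pair_pre_digraph \<Rightarrow> 'a set \<Rightarrow> bool" where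
  "independent_set G S \<longleftrightarrow> S \<subseteq> pverts G \<and> (\<forall>u \<in> S. \<forall>v \<in> S. (u, v) \<notin> parcs G)"

definition independence_number :: "'a pair_pre_digraph \<Rightarrow> nat" where
  "independence_number G = Max {card S | S. independent_set G S}"

definition shannon_capacity :: "'a pair_pre_digraph \<Rightarrow> real" where
  "shannon_capacity G = lim (\<lambda>n. root n (real (independence_number (strong_power G n))))"

definition single_shot :: "'a pair_pre_digraph \<Rightarrow> bool" where
  "single_shot G \<longleftrightarrow> real (independence_number G) = shannon_capacity G"

definition unit_vec_in :: "nat \<Rightarrow> real vec \<Rightarrow> bool" where
  "unit_vec_in d x \<longleftrightarrow> x \<in> carrier_vec d \<and> x \<bullet> x = 1"

definition orthonormal_labeling :: "'a pair_pre_digraph \<Rightarrow> ('a \<Rightarrow> real vec) \<Rightarrow> bool" where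
  "orthonormal_labeling G \<psi> \<longleftrightarrow>
     (\<forall>v \<in> pverts G. unit_vec_in (card (pverts G)) (\<psi> v)) \<and>
     (\<forall>u \<in> pverts G. \<forall>v \<in> pverts G. u \<noteq> v \<and> (u, v) \<notin> parcs G \<longrightarrow> \<psi> u \<bullet> \<psi> v = 0)"

text \<open>
  The values are extended reals because \<open>1 / 0 = \<infinity>\<close> is needed here, whereas \<open>1 / 0 = 0\<close>
  on \<^typ>\<open>real\<close>. The infimum is a minimum, by compactness of the space of labelings.
\<close>

definition lovasz_number :: "'a pair_pre_digraph \<Rightarrow> ereal" where
  "lovasz_number G =
     Inf {Max ((\<lambda>v. 1 / (ereal \<bar>\<Psi> \<bullet> \<psi> v\<bar>)\<^sup>2) ` pverts G) | \<Psi> \<psi>.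
            unit_vec_in (card (pverts G)) \<Psi> \<and> orthonormal_labeling G \<psi>}"

end

theory Submission
  imports Defs "HOL-Library.FuncSet" "HOL-Library.Nat_Bijection"
begin

text \<open>
  Take as vertices the 63 odd subsets of a 7-element set other than the whole set. Two of them are
  adjacent in \<open>G1\<close> if they meet in an odd number of points, and in \<open>G2\<close> if they meet in an even
  number, so \<open>G2\<close> is the complement of \<open>G1\<close>. Characteristic vectors over the field with two
  elements, together with their tensor powers, give \<open>\<alpha>(G1^n) \<le> 7^n\<close>, and the singletons attain
  7. The lines of the Fano plane show \<open>\<alpha>(G2) \<ge> 7\<close>, and an explicit orthonormal labeling shows
  \<open>\<theta>(G2) \<le> 7\<close>. The diagonal of the product of complementary graphs is independent,
  so \<open>\<alpha>(G1 \<times> G2) \<ge> 63 > 49\<close>. For the disjoint union, expand its strong square: the two mixed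
  terms give an independent set with at least \<open>49 + 49 + 2 * 63 > (7 + 7)^2\<close> vertices.
\<close>

section \<open>Supermultiplicative sequences\<close>

lemma supermultiplicative_power_le:
  fixes a :: "nat \<Rightarrow> real"
  assumes "\<And>m n. a m * a n \<le> a (m + n)" "\<And>n. 1 \<le> a n"
  shows "a k ^ q \<le> a (q * k)"
proof (induction q)
  case 0
  then show ?case using assms(2) by simp
next
  case (Suc q)
  have "a k ^ Suc q \<le> a k * a (q * k)"
    using Suc assms(2)[of k] by (simp add: mult_left_mono)
  also have "\<dots> \<le> a (Suc q * k)"
    using assms(1)[of k "q * k"] by simp
  finally show ?case .
qed

text \<open>With q = \<open>n div k\<close>, \<open>a k ^ q\<close> is at most \<open>a n\<close>,
  because the remaining factor \<open>a (n mod k)\<close> is at least 1. Rounding n up to a multiple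
  of k costs one more factor \<open>a k\<close>; its n-th root is the denominator, which tends to
  1.\<close>

lemma supermultiplicative_root_ge:
  fixes a :: "nat \<Rightarrow> real"
  assumes super: "\<And>m n. a m * a n \<le> a (m + n)" and one: "\<And>n. 1 \<le> a n"
    and "k > 0" "n > 0"
  shows "root k (a k) / root n (a k) \<le> root n (a n)"
proof -
  define r where "r = root k (a k)"
  have r1: "1 \<le> r" and rk: "r ^ k = a k"
    using one[of k] \<open>k > 0\<close> by (auto simp: r_def real_root_pow_pos2)
  have "n \<le> k * (n div k) + k"
    by (metis add_le_cancel_left \<open>k > 0\<close> less_imp_le mod_less_divisor mult_div_mod_eq)
  then have "r ^ n \<le> r ^ (k * (n div k) + k)"
    using r1 by (rule power_increasing)
  also have "\<dots> = a k ^ (n div k) * a k"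
    by (simp add: power_add power_mult rk)
  also have "\<dots> \<le> a n * a k"
  proof -
    have "a k ^ (n div k) * 1 \<le> a (n div k * k) * a (n mod k)"
      using supermultiplicative_power_le[of a k "n div k"] super one one[of "n mod k"]
        order_trans[OF zero_le_one one[of "n div k * k"]]
      by (intro mult_mono) auto
    also have "\<dots> \<le> a n"
      using super[of "n div k * k" "n mod k"] by simp
    finally show ?thesis
      using one[of k] by (simp add: mult_right_mono)
  qed
  finally have "root n (r ^ n) \<le> root n (a n * a k)"
    using \<open>n > 0\<close> by simp
  then have "r \<le> root n (a n) * root n (a k)"
    using \<open>n > 0\<close> r1 by (simp add: real_root_power_cancel real_root_mult)
  moreover have "root n (a k) > 0"
    using one[of k] \<open>n > 0\<close> by simp
  ultimately show ?thesis
    by (simp add: r_def divide_le_eq)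
qed

text \<open>Fekete's lemma: the n-th roots converge to their supremum, which the bound
  \<open>c ^ n\<close> keeps finite. Convergence has to be established because \<open>lim\<close> is
  unspecified on divergent sequences.\<close>

lemma supermultiplicative_root_le_lim:
  fixes a :: "nat \<Rightarrow> real"
  assumes super: "\<And>m n. a m * a n \<le> a (m + n)" and one: "\<And>n. 1 \<le> a n"
    and upper: "\<And>n. a n \<le> c ^ n" and "c \<ge> 0" "k > 0"
  shows "root k (a k) \<le> lim (\<lambda>n. root n (a n))"
proof -
  define s where "s = (SUP n\<in>{0<..}. root n (a n))"
  have le_c: "root n (a n) \<le> c" if "n > 0" for n
  proof -
    have "root n (a n) \<le> root n (c ^ n)"
      using upper that by simp
    then show ?thesis
      using that \<open>c \<ge> 0\<close> by (simp add: real_root_power_cancel)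
  qed
  have bdd: "bdd_above ((\<lambda>n. root n (a n)) ` {0<..})"
    by (rule bdd_aboveI2[of _ _ c]) (use le_c in auto)
  have le_s: "root n (a n) \<le> s" if "n > 0" for n
    unfolding s_def by (rule cSUP_upper[OF _ bdd]) (use that in auto)
  have "(\<lambda>n. root n (a n)) \<longlonglongrightarrow> s"
  proof (rule order_tendstoI)
    fix y assume "y < s"
    then obtain m where m: "m > 0" "y < root m (a m)"
      unfolding s_def using less_cSUP_iff[OF _ bdd, of y] by auto
    \<comment> \<open>Letting n grow with m fixed makes the correcting denominator
      disappear.\<close>
    have "(\<lambda>n. root m (a m) / root n (a m)) \<longlonglongrightarrow> root m (a m) / 1"
      using one[of m] by (intro tendsto_divide tendsto_const LIMSEQ_root_const) auto
    then have "\<forall>\<^sub>F n in sequentially. y < root m (a m) / root n (a m)"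
      using m by (intro order_tendstoD(1)) auto
    then show "\<forall>\<^sub>F n in sequentially. y < root n (a n)"
      using eventually_gt_at_top[of 0]
    proof eventually_elim
      case (elim n)
      then show ?case
        using supermultiplicative_root_ge[of a m n] super one \<open>m > 0\<close> by fastforce
    qed
  next
    fix y assume "s < y"
    show "\<forall>\<^sub>F n in sequentially. root n (a n) < y"
      using eventually_gt_at_top[of 0]
    proof eventually_elim
      case (elim n)
      then show ?case
        using le_s[of n] \<open>s < y\<close> by linarith
    qed
  qed
  then show ?thesis
    using le_s[OF \<open>k > 0\<close>] by (simp add: limI)
qed

section \<open>Independent sets in strong powers\<close>

lemma pverts_strong_power:
  "pverts (strong_power G n) = {us. set us \<subseteq> pverts G \<and> length us = n}"
  by (auto simp: strong_power_def Let_def)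

lemma finite_pverts_strong_power:
  "finite (pverts G) \<Longrightarrow> finite (pverts (strong_power G n))"
  unfolding pverts_strong_power by (rule finite_lists_length_eq)

lemma finite_independent_cards:
  assumes "finite (pverts G)"
  shows "finite {card S | S. independent_set G S}"
proof (rule finite_subset)
  show "{card S | S. independent_set G S} \<subseteq> card ` Pow (pverts G)"
    by (auto simp: independent_set_def)
qed (use assms in auto)

lemma card_le_independence_number:
  assumes "finite (pverts G)" "independent_set G S"
  shows "card S \<le> independence_number G"
  unfolding independence_number_def
  by (rule Max_ge) (use assms finite_independent_cards in auto)

lemma independence_number_attained:
  assumes "finite (pverts G)"
  obtains S where "independent_set G S" "card S = independence_number G"
proof -
  have "independent_set G {}"
    by (simp add: independent_set_def)
  then have "independence_number G \<in> {card S | S. independent_set G S}"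
    unfolding independence_number_def
    by (intro Max_in finite_independent_cards assms) auto
  then show thesis
    using that by auto
qed

lemma independent_set_strong_power_iff:
  "independent_set (strong_power G n) S \<longleftrightarrow>
     (\<forall>us \<in> S. length us = n \<and> set us \<subseteq> pverts G) \<and>
     (\<forall>us \<in> S. \<forall>vs \<in> S. us \<noteq> vs \<longrightarrow> \<not> list_all2 (adj_or_eq G) us vs)"
  unfolding independent_set_def strong_power_def Let_def by auto blast

text \<open>Two distinct concatenations differ in one of their halves, and a coordinate that
  prevents adjacency there prevents it for the whole word.\<close>

lemma independence_number_strong_power_mult:
  assumes "finite (pverts G)"
  shows "independence_number (strong_power G m) * independence_number (strong_power G n)
           \<le> independence_number (strong_power G (m + n))"
proof -
  obtain S where S: "independent_set (strong_power G m) S"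
    "card S = independence_number (strong_power G m)"
    using independence_number_attained finite_pverts_strong_power[OF assms] by blast
  obtain T where T: "independent_set (strong_power G n) T"
    "card T = independence_number (strong_power G n)"
    using independence_number_attained finite_pverts_strong_power[OF assms] by blast
  let ?c = "\<lambda>(us, vs). us @ vs"
  have inj: "inj_on ?c (S \<times> T)"
    using S(1) T(1) by (auto simp: inj_on_def independent_set_strong_power_iff)
  have "independent_set (strong_power G (m + n)) (?c ` (S \<times> T))"
    using S(1) T(1) unfolding independent_set_strong_power_iff
    by (auto simp: list_all2_append)
  from card_le_independence_number[OF finite_pverts_strong_power[OF assms] this]
  show ?thesis
    by (simp add: card_image[OF inj] card_cartesian_product S T)
qed

lemma independence_number_strong_power_ge_1:
  assumes "finite (pverts G)" "pverts G \<noteq> {}"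
  shows "1 \<le> independence_number (strong_power G n)"
proof -
  obtain v where "v \<in> pverts G"
    using assms by blast
  then have "independent_set (strong_power G n) {replicate n v}"
    by (auto simp: independent_set_strong_power_iff)
  from card_le_independence_number[OF finite_pverts_strong_power[OF assms(1)] this]
  show ?thesis by simp
qed

lemma independence_number_strong_power_le:
  assumes "finite (pverts G)"
  shows "independence_number (strong_power G n) \<le> card (pverts G) ^ n"
proof -
  obtain S where S: "independent_set (strong_power G n) S"
    "card S = independence_number (strong_power G n)"
    using independence_number_attained finite_pverts_strong_power[OF assms] by blast
  have "card S \<le> card {us. set us \<subseteq> pverts G \<and> length us = n}"
    using S(1) by (intro card_mono finite_lists_length_eq assms)
      (auto simp: independent_set_strong_power_iff)
  then show ?thesis
    using S assms by (simp add: card_lists_length_eq)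
qed

lemma independence_number_le_strong_power_1:
  assumes "finite (pverts G)"
  shows "independence_number G \<le> independence_number (strong_power G 1)"
proof -
  obtain S where S: "independent_set G S" "card S = independence_number G"
    using independence_number_attained[OF assms] by blast
  have "independent_set (strong_power G 1) ((\<lambda>v. [v]) ` S)"
    using S(1) unfolding independent_set_strong_power_iff
    by (auto simp: independent_set_def adj_or_eq_def)
  from card_le_independence_number[OF finite_pverts_strong_power[OF assms] this]
  show ?thesis
    using S(2) by (simp add: card_image inj_on_def)
qed

lemma root_independence_number_le_shannon_capacity:
  assumes "finite (pverts G)" "pverts G \<noteq> {}" "k > 0"
  shows "root k (real (independence_number (strong_power G k))) \<le> shannon_capacity G"
  unfolding shannon_capacity_def
proof (rule supermultiplicative_root_le_lim[where c = "real (card (pverts G))"])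
  show "real (independence_number (strong_power G m)) * real (independence_number (strong_power G n))
          \<le> real (independence_number (strong_power G (m + n)))" for m n
    using independence_number_strong_power_mult[OF assms(1)]
    by (metis of_nat_le_iff of_nat_mult)
  show "real (independence_number (strong_power G n)) \<le> real (card (pverts G)) ^ n" for n
    using independence_number_strong_power_le[OF assms(1)]
    by (metis of_nat_le_iff of_nat_power)
  show "1 \<le> real (independence_number (strong_power G n))" for n
    using independence_number_strong_power_ge_1[OF assms(1,2), of n] by linarith
qed (use assms in auto)

lemma independence_number_le_shannon_capacity:
  assumes "finite (pverts G)" "pverts G \<noteq> {}"
  shows "real (independence_number G) \<le> shannon_capacity G"
  using root_independence_number_le_shannon_capacity[OF assms, of 1]
    independence_number_le_strong_power_1[OF assms(1)]
  by simp

text \<open>Concatenation supplies the lower bound \<open>m ^ n\<close> matching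
  \<open>upper\<close>, so the roots are constant for n > 0 and the limit is read off. This is the
  criterion for being single-shot.\<close>

lemma shannon_capacity_eqI:
  assumes fin: "finite (pverts G)" and "m \<le> independence_number G"
    and upper: "\<And>n. independence_number (strong_power G n) \<le> m ^ n"
  shows "independence_number G = m" "shannon_capacity G = real m"
proof -
  have "independence_number G \<le> m"
    using upper[of 1] independence_number_le_strong_power_1[OF fin] by simp
  then show m: "independence_number G = m"
    using assms(2) by simp
  have power: "m ^ n \<le> independence_number (strong_power G n)" for n
  proof (induction n)
    case 0
    have "independent_set (strong_power G 0) {[]}"
      by (simp add: independent_set_strong_power_iff)
    from card_le_independence_number[OF finite_pverts_strong_power[OF fin] this]
    show ?case by simp
  next
    case (Suc n)
    have "m * m ^ n \<le> independence_number (strong_power G 1) * independence_number (strong_power G n)"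
      using Suc independence_number_le_strong_power_1[OF fin] m by (intro mult_le_mono) auto
    also have "\<dots> \<le> independence_number (strong_power G (Suc n))"
      using independence_number_strong_power_mult[OF fin, of 1 n] by simp
    finally show ?case by simp
  qed
  \<comment> \<open>Index 0 is left out because \<open>root 0\<close> is constantly 0.\<close>
  have "\<forall>\<^sub>F n in sequentially. root n (real (independence_number (strong_power G n))) = real m"
    using eventually_gt_at_top[of 0]
  proof eventually_elim
    case (elim n)
    have "independence_number (strong_power G n) = m ^ n"
      using power upper by (intro antisym) auto
    then show ?case
      using elim by (simp add: real_root_power_cancel)
  qed
  then show "shannon_capacity G = real m"
    unfolding shannon_capacity_def by (intro limI tendsto_eventually)
qed

section \<open>Upper bounds from parity and from orthonormal labelings\<close>

text \<open>
  Linear independence over the field with two elements, by counting: a subfamily \<open>T\<close> is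
  recovered from the sum of its characteristic vectors.
\<close>

lemma oddtown:
  fixes A :: "'s \<Rightarrow> 'i set"
  assumes fin: "finite S" "finite I" and sub: "\<And>s. s \<in> S \<Longrightarrow> A s \<subseteq> I"
    and odd: "\<And>s. s \<in> S \<Longrightarrow> odd (card (A s))"
    and even: "\<And>s t. s \<in> S \<Longrightarrow> t \<in> S \<Longrightarrow> s \<noteq> t \<Longrightarrow> even (card (A s \<inter> A t))"
  shows "card S \<le> card I"
proof -
  define h where "h T = {i \<in> I. odd (card {s \<in> T. i \<in> A s})}" for T
  \<comment> \<open>\<open>h T\<close> is the sum modulo 2 of the characteristic vectors of the
    \<open>A s\<close> with s in \<open>T\<close>. Its inner product with that of \<open>A t\<close>
    is a sum of intersection sizes in which only s = t gives an odd term.\<close>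
  have recover: "t \<in> T \<longleftrightarrow> odd (card (h T \<inter> A t))" if "T \<subseteq> S" "t \<in> S" for T t
  proof -
    have finT: "finite T" and finA: "finite (A t)"
      using that fin sub finite_subset by metis+
    have "even (card (h T \<inter> A t)) \<longleftrightarrow> even (card {i \<in> A t. odd (card {s \<in> T. i \<in> A s})})"
      using sub[OF \<open>t \<in> S\<close>] by (intro arg_cong[where f = "\<lambda>X. even (card X)"]) (auto simp: h_def)
    also have "\<dots> \<longleftrightarrow> even (\<Sum>i\<in>A t. card {s \<in> T. i \<in> A s})"
      using finA by (simp add: even_sum_iff)
    also have "(\<Sum>i\<in>A t. card {s \<in> T. i \<in> A s}) = (\<Sum>s\<in>T. card (A s \<inter> A t))"
    proof -
      have "(\<Sum>i\<in>A t. card {s \<in> T. i \<in> A s}) = (\<Sum>i\<in>A t. \<Sum>s\<in>T. of_bool (i \<in> A s))"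
        using finT by (simp add: Int_def)
      also have "\<dots> = (\<Sum>s\<in>T. \<Sum>i\<in>A t. of_bool (i \<in> A s))"
        by (rule sum.swap)
      also have "\<dots> = (\<Sum>s\<in>T. card (A s \<inter> A t))"
        using finA by (simp add: Int_def conj_commute)
      finally show ?thesis .
    qed
    also have "even \<dots> \<longleftrightarrow> even (card {s \<in> T. odd (card (A s \<inter> A t))})"
      using finT by (simp add: even_sum_iff)
    also have "{s \<in> T. odd (card (A s \<inter> A t))} = (if t \<in> T then {t} else {})"
      using that even odd by (auto split: if_splits)
    finally show ?thesis by (simp split: if_splits)
  qed
  have "inj_on h (Pow S)"
  proof (rule inj_onI)
    fix T T' assume "T \<in> Pow S" "T' \<in> Pow S" "h T = h T'"
    then have "t \<in> T \<longleftrightarrow> t \<in> T'" if "t \<in> S" for t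
      using recover[of T t] recover[of T' t] that by auto
    then show "T = T'"
      using \<open>T \<in> Pow S\<close> \<open>T' \<in> Pow S\<close> by blast
  qed
  then have "card (Pow S) \<le> card (Pow I)"
    using fin by (intro card_inj_on_le[of h]) (auto simp: h_def)
  then show ?thesis
    using fin by (simp add: card_Pow)
qed

text \<open>Sizes of boxes multiply over coordinates: a box of odd sets is odd, and a single
  coordinate with even intersection makes two boxes meet evenly. The boxes of an independent set
  thus satisfy \<open>oddtown\<close> inside a set of \<open>card I ^ n\<close> points. This is a
  bound of Haemers type over the field with two elements.\<close>

lemma independence_number_strong_power_le_parity:
  fixes A :: "'a \<Rightarrow> 'i set"
  assumes fin: "finite (pverts G)" "finite I" and sub: "\<And>v. v \<in> pverts G \<Longrightarrow> A v \<subseteq> I"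
    and odd: "\<And>v. v \<in> pverts G \<Longrightarrow> odd (card (A v))"
    and even: "\<And>u v. u \<in> pverts G \<Longrightarrow> v \<in> pverts G \<Longrightarrow> u \<noteq> v \<Longrightarrow> (u, v) \<notin> parcs G
                 \<Longrightarrow> even (card (A u \<inter> A v))"
  shows "independence_number (strong_power G n) \<le> card I ^ n"
proof -
  obtain S where S: "independent_set (strong_power G n) S"
    "card S = independence_number (strong_power G n)"
    using independence_number_attained finite_pverts_strong_power[OF fin(1)] by blast
  have len: "length us = n" and verts: "\<And>i. i < n \<Longrightarrow> us ! i \<in> pverts G" if "us \<in> S" for us
    using that S(1) by (force simp: independent_set_strong_power_iff subset_iff)+
  define B where "B us = PiE {..<n} (\<lambda>i. A (us ! i))" for us
  have "finite S"
    using S(1) finite_pverts_strong_power[OF fin(1)] finite_subset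
    by (auto simp: independent_set_def)
  moreover have "finite (PiE {..<n} (\<lambda>_. I))"
    using fin by (intro finite_PiE) auto
  moreover have "B us \<subseteq> PiE {..<n} (\<lambda>_. I)" if "us \<in> S" for us
    unfolding B_def using that verts sub by (intro PiE_mono) auto
  moreover have "odd (card (B us))" if "us \<in> S" for us
    unfolding B_def using that verts odd by (auto simp: card_PiE even_prod_iff)
  moreover have "even (card (B us \<inter> B vs))" if "us \<in> S" "vs \<in> S" "us \<noteq> vs" for us vs
  proof -
    have "\<not> list_all2 (adj_or_eq G) us vs"
      using that S(1) by (auto simp: independent_set_strong_power_iff)
    moreover have "length us = n" "length vs = n"
      using that len by auto
    ultimately obtain i where i: "i < n" "\<not> adj_or_eq G (us ! i) (vs ! i)"
      by (auto simp: list_all2_conv_all_nth)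
    then have "even (card (A (us ! i) \<inter> A (vs ! i)))"
      using that verts even by (auto simp: adj_or_eq_def)
    then show ?thesis
      unfolding B_def PiE_Int using i by (auto simp: card_PiE even_prod_iff)
  qed
  ultimately have "card S \<le> card (PiE {..<n} (\<lambda>_. I))"
    by (rule oddtown)
  then show ?thesis
    using S by (simp add: card_PiE)
qed

section \<open>Bessel's inequality and the Lovasz bound\<close>

text \<open>The squared distance from \<open>p\<close> to its projection onto the span of the
  \<open>f s\<close> is nonnegative. Functions on an index set take the place of vectors so that
  coordinates of tensor powers can serve as indices.\<close>

lemma bessel_inequality_finite:
  fixes f :: "'s \<Rightarrow> 'i \<Rightarrow> real"
  assumes fin: "finite S"
    and ortho: "\<And>s t. s \<in> S \<Longrightarrow> t \<in> S \<Longrightarrow> (\<Sum>i\<in>I. f s i * f t i) = of_bool (s = t)"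
    and unit: "(\<Sum>i\<in>I. p i * p i) = 1"
  shows "(\<Sum>s\<in>S. (\<Sum>i\<in>I. p i * f s i)\<^sup>2) \<le> 1"
proof -
  define c where "c s = (\<Sum>i\<in>I. p i * f s i)" for s
  have cross: "(\<Sum>i\<in>I. p i * (\<Sum>s\<in>S. c s * f s i)) = (\<Sum>s\<in>S. (c s)\<^sup>2)"
  proof -
    have "(\<Sum>i\<in>I. p i * (\<Sum>s\<in>S. c s * f s i)) = (\<Sum>s\<in>S. c s * c s)"
      unfolding c_def[of "_"] sum_distrib_left
      by (subst sum.swap) (simp add: mult_ac sum_distrib_left)
    then show ?thesis by (simp add: power2_eq_square)
  qed
  have square: "(\<Sum>i\<in>I. (\<Sum>s\<in>S. c s * f s i)\<^sup>2) = (\<Sum>s\<in>S. (c s)\<^sup>2)"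
  proof -
    have "(\<Sum>i\<in>I. (\<Sum>s\<in>S. c s * f s i)\<^sup>2) = (\<Sum>i\<in>I. \<Sum>s\<in>S. \<Sum>t\<in>S. (c s * f s i) * (c t * f t i))"
      by (simp add: power2_eq_square sum_product)
    also have "\<dots> = (\<Sum>s\<in>S. \<Sum>t\<in>S. \<Sum>i\<in>I. (c s * f s i) * (c t * f t i))"
      by (subst sum.swap) (intro sum.cong refl sum.swap)
    also have "\<dots> = (\<Sum>s\<in>S. \<Sum>t\<in>S. c s * c t * (\<Sum>i\<in>I. f s i * f t i))"
      by (simp add: sum_distrib_left mult_ac)
    also have "\<dots> = (\<Sum>s\<in>S. \<Sum>t\<in>S. c s * c t * of_bool (s = t))"
      by (intro sum.cong refl) (simp add: ortho)
    also have "\<dots> = (\<Sum>s\<in>S. (c s)\<^sup>2)"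
      using fin by (simp add: of_bool_def if_distrib power2_eq_square cong: if_cong)
    finally show ?thesis .
  qed
  have "0 \<le> (\<Sum>i\<in>I. (p i - (\<Sum>s\<in>S. c s * f s i))\<^sup>2)"
    by (intro sum_nonneg) simp
  also have "\<dots> = (\<Sum>i\<in>I. p i * p i) - 2 * (\<Sum>i\<in>I. p i * (\<Sum>s\<in>S. c s * f s i))
                   + (\<Sum>i\<in>I. (\<Sum>s\<in>S. c s * f s i)\<^sup>2)"
    by (simp add: power2_diff sum.distrib sum_subtractf mult.assoc flip: sum_distrib_left)
      (simp add: power2_eq_square)
  also have "\<dots> = 1 - (\<Sum>s\<in>S. (c s)\<^sup>2)"
    using cross square unit by simp
  finally show ?thesis by (simp add: c_def)
qed

text \<open>Tensor products of labels along the words of an independent set are orthonormal, and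
  each has squared overlap at least \<open>(1 / c) ^ n\<close> with the n-th tensor power of
  \<open>\<Psi>\<close>. Bessel's inequality then bounds the number of words.\<close>

lemma independence_number_strong_power_le_labeling:
  assumes fin: "finite (pverts G)"
    and \<Psi>: "unit_vec_in (card (pverts G)) \<Psi>" and \<psi>: "orthonormal_labeling G \<psi>"
    and c: "c > 0" "\<And>v. v \<in> pverts G \<Longrightarrow> 1 / c \<le> (\<Psi> \<bullet> \<psi> v)\<^sup>2"
  shows "real (independence_number (strong_power G n)) \<le> c ^ n"
proof -
  obtain S where S: "independent_set (strong_power G n) S"
    "card S = independence_number (strong_power G n)"
    using independence_number_attained finite_pverts_strong_power[OF fin(1)] by blast
  define d where "d = card (pverts G)"
  have len: "length us = n" and verts: "\<And>i. i < n \<Longrightarrow> us ! i \<in> pverts G" if "us \<in> S" for us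
    using that S(1) by (force simp: independent_set_strong_power_iff subset_iff)+
  have finS: "finite S"
    using S(1) finite_pverts_strong_power[OF fin(1)] finite_subset
    by (auto simp: independent_set_def)
  \<comment> \<open>The functions in \<open>J\<close> index the coordinates of the n-fold tensor
    power; \<open>f us\<close> and \<open>p\<close> are the tensor products of the labels and of n
    copies of \<open>\<Psi>\<close>.\<close>
  define J where "J = PiE {..<n} (\<lambda>_. {0..<d})"
  define f where "f us g = (\<Prod>i<n. \<psi> (us ! i) $ g i)" for us and g :: "nat \<Rightarrow> nat"
  define p where "p g = (\<Prod>i<n. \<Psi> $ g i)" for g :: "nat \<Rightarrow> nat"
  \<comment> \<open>Inner products of tensors factor by distributing the product over the sums. The
    premise speaks of \<open>y\<close> because \<open>\<bullet>\<close> sums over the dimension of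
    its right argument.\<close>
  have tensor: "(\<Sum>g\<in>J. (\<Prod>i<n. x i $ g i) * (\<Prod>i<n. y i $ g i)) = (\<Prod>i<n. x i \<bullet> y i)"
    if "\<And>i. i < n \<Longrightarrow> dim_vec (y i) = d" for x y :: "nat \<Rightarrow> real vec"
  proof -
    have "(\<Prod>i<n. x i \<bullet> y i) = (\<Prod>i<n. \<Sum>j\<in>{0..<d}. x i $ j * y i $ j)"
      using that by (intro prod.cong) (auto simp: scalar_prod_def)
    also have "\<dots> = (\<Sum>g\<in>J. \<Prod>i<n. x i $ g i * y i $ g i)"
      unfolding J_def by (rule prod_sum_PiE) auto
    finally show ?thesis by (simp add: prod.distrib)
  qed
  have dim: "dim_vec \<Psi> = d" "\<And>v. v \<in> pverts G \<Longrightarrow> dim_vec (\<psi> v) = d"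
    and unit: "\<Psi> \<bullet> \<Psi> = 1" "\<And>v. v \<in> pverts G \<Longrightarrow> \<psi> v \<bullet> \<psi> v = 1"
    using \<Psi> \<psi> by (auto simp: d_def unit_vec_in_def orthonormal_labeling_def)
  have "(\<Sum>g\<in>J. f us g * f vs g) = of_bool (us = vs)" if "us \<in> S" "vs \<in> S" for us vs
  proof (cases "us = vs")
    case True
    then show ?thesis
      using that verts dim unit by (simp add: f_def tensor)
  next
    case False
    have "\<not> list_all2 (adj_or_eq G) us vs"
      using that False S(1) by (auto simp: independent_set_strong_power_iff)
    moreover have "length us = n" "length vs = n"
      using that len by auto
    ultimately obtain i where i: "i < n" "\<not> adj_or_eq G (us ! i) (vs ! i)"
      by (auto simp: list_all2_conv_all_nth)
    then have "\<psi> (us ! i) \<bullet> \<psi> (vs ! i) = 0"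
      using that verts \<psi> by (auto simp: adj_or_eq_def orthonormal_labeling_def)
    with i have "(\<Prod>i<n. \<psi> (us ! i) \<bullet> \<psi> (vs ! i)) = 0"
      by (intro prod_zero) auto
    then show ?thesis
      using that verts dim False by (simp add: f_def tensor)
  qed
  moreover have "(\<Sum>g\<in>J. p g * p g) = 1"
    using dim unit by (simp add: p_def tensor)
  ultimately have bessel: "(\<Sum>us\<in>S. (\<Sum>g\<in>J. p g * f us g)\<^sup>2) \<le> 1"
    using finS by (intro bessel_inequality_finite)
  have "(1 / c) ^ n \<le> (\<Sum>g\<in>J. p g * f us g)\<^sup>2" if "us \<in> S" for us
  proof -
    have "(\<Sum>g\<in>J. p g * f us g)\<^sup>2 = (\<Prod>i<n. (\<Psi> \<bullet> \<psi> (us ! i))\<^sup>2)"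
      using that verts dim by (simp add: p_def f_def tensor prod_power_distrib)
    moreover have "(\<Prod>i<n. 1 / c) \<le> (\<Prod>i<n. (\<Psi> \<bullet> \<psi> (us ! i))\<^sup>2)"
      using that verts c by (intro prod_mono) auto
    ultimately show ?thesis by simp
  qed
  then have "real (card S) * (1 / c) ^ n \<le> (\<Sum>us\<in>S. (\<Sum>g\<in>J. p g * f us g)\<^sup>2)"
    by (rule sum_bounded_below)
  with bessel have "real (card S) * (1 / c) ^ n \<le> 1"
    by linarith
  then show ?thesis
    using c(1) S(2) by (simp add: power_divide field_simps)
qed

lemma inverse_square_ereal:
  "1 / (ereal \<bar>t\<bar>)\<^sup>2 = (if t = 0 then \<infinity> else ereal (1 / t\<^sup>2))"
  by (auto simp: one_ereal_def zero_ereal_def[symmetric])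

text \<open>For each \<open>\<Psi>\<close> and labeling, a finite maximum c excludes labels
  orthogonal to \<open>\<Psi>\<close> and serves as the constant of the previous bound at n = 1; an
  infinite maximum is trivial.\<close>

lemma independence_number_le_lovasz_number:
  assumes fin: "finite (pverts G)" "pverts G \<noteq> {}"
  shows "ereal (real (independence_number G)) \<le> lovasz_number G"
  unfolding lovasz_number_def
proof (rule Inf_greatest, clarify)
  fix \<Psi> \<psi>
  assume \<Psi>: "unit_vec_in (card (pverts G)) \<Psi>" and \<psi>: "orthonormal_labeling G \<psi>"
  let ?M = "Max ((\<lambda>v. 1 / (ereal \<bar>\<Psi> \<bullet> \<psi> v\<bar>)\<^sup>2) ` pverts G)"
  have le: "(if \<Psi> \<bullet> \<psi> v = 0 then \<infinity> else ereal (1 / (\<Psi> \<bullet> \<psi> v)\<^sup>2)) \<le> ?M"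
    if "v \<in> pverts G" for v
    unfolding inverse_square_ereal[symmetric] using that fin by simp
  obtain v0 where v0: "v0 \<in> pverts G"
    using fin by blast
  show "ereal (real (independence_number G)) \<le> ?M"
  proof (cases ?M)
    case (real c)
    have pos: "\<Psi> \<bullet> \<psi> v \<noteq> 0" and bound: "1 / (\<Psi> \<bullet> \<psi> v)\<^sup>2 \<le> c" if "v \<in> pverts G" for v
      using le[OF that] unfolding real by (auto split: if_splits)
    have "0 < 1 / (\<Psi> \<bullet> \<psi> v0)\<^sup>2"
      using pos[OF v0] by simp
    then have "c > 0"
      using bound[OF v0] by linarith
    have "1 / c \<le> (\<Psi> \<bullet> \<psi> v)\<^sup>2" if "v \<in> pverts G" for v
      using bound[OF that] pos[OF that] \<open>c > 0\<close> by (simp add: field_simps)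
    from independence_number_strong_power_le_labeling[OF fin(1) \<Psi> \<psi> \<open>c > 0\<close> this, of 1]
    show ?thesis
      using independence_number_le_strong_power_1[OF fin(1)] unfolding real by simp
  next
    case MInf
    then show ?thesis
      using le[OF v0] by (auto split: if_splits)
  qed simp
qed

lemma lovasz_number_le:
  assumes fin: "finite (pverts G)" "pverts G \<noteq> {}"
    and "unit_vec_in (card (pverts G)) \<Psi>" "orthonormal_labeling G \<psi>"
    and c: "c > 0" "\<And>v. v \<in> pverts G \<Longrightarrow> 1 / c \<le> (\<Psi> \<bullet> \<psi> v)\<^sup>2"
  shows "lovasz_number G \<le> ereal c"
  unfolding lovasz_number_def
proof (rule Inf_lower2)
  show "Max ((\<lambda>v. 1 / (ereal \<bar>\<Psi> \<bullet> \<psi> v\<bar>)\<^sup>2) ` pverts G) \<le> ereal c"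
  proof (rule Max.boundedI)
    fix x assume "x \<in> (\<lambda>v. 1 / (ereal \<bar>\<Psi> \<bullet> \<psi> v\<bar>)\<^sup>2) ` pverts G"
    then obtain v where v: "v \<in> pverts G" "x = 1 / (ereal \<bar>\<Psi> \<bullet> \<psi> v\<bar>)\<^sup>2"
      by blast
    have "0 < (\<Psi> \<bullet> \<psi> v)\<^sup>2"
      using c(2)[OF v(1)] c(1) by (meson less_le_trans zero_less_divide_1_iff)
    then show "x \<le> ereal c"
      using c(2)[OF v(1)] c(1) unfolding v(2) inverse_square_ereal
      by (auto simp: field_simps)
  qed (use fin in auto)
qed (use assms in blast)

text \<open>A bijection of \<open>J\<close> with an initial segment of the naturals preserves inner
  products, so labels may be given in coordinates indexed by any set of the right size. Below, the
  odd sets themselves are the coordinates.\<close>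

lemma labeling_of_functions:
  fixes F :: "'a \<Rightarrow> 'j \<Rightarrow> real"
  assumes J: "finite J" "card J = card (pverts G)"
    and P: "(\<Sum>j\<in>J. P j * P j) = 1"
    and unit: "\<And>v. v \<in> pverts G \<Longrightarrow> (\<Sum>j\<in>J. F v j * F v j) = 1"
    and ortho: "\<And>u v. u \<in> pverts G \<Longrightarrow> v \<in> pverts G \<Longrightarrow> u \<noteq> v \<Longrightarrow> (u, v) \<notin> parcs G
                  \<Longrightarrow> (\<Sum>j\<in>J. F u j * F v j) = 0"
  obtains \<Psi> \<psi> where "unit_vec_in (card (pverts G)) \<Psi>" "orthonormal_labeling G \<psi>"
    "\<And>v. \<Psi> \<bullet> \<psi> v = (\<Sum>j\<in>J. P j * F v j)"
proof -
  let ?d = "card (pverts G)"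
  obtain e where e: "bij_betw e {0..<?d} J"
    using ex_bij_betw_nat_finite[OF J(1)] J(2) by auto
  have dot: "vec ?d (\<lambda>i. f (e i)) \<bullet> vec ?d (\<lambda>i. g (e i)) = (\<Sum>j\<in>J. f j * g j)" for f g :: "'j \<Rightarrow> real"
    using sum.reindex_bij_betw[OF e, of "\<lambda>j. f j * g j"] by (simp add: scalar_prod_def)
  show thesis
  proof (rule that)
    show "unit_vec_in ?d (vec ?d (\<lambda>i. P (e i)))"
      unfolding unit_vec_in_def dot using P by simp
    show "orthonormal_labeling G (\<lambda>v. vec ?d (\<lambda>i. F v (e i)))"
      unfolding orthonormal_labeling_def unit_vec_in_def dot using unit ortho by simp
    show "vec ?d (\<lambda>i. P (e i)) \<bullet> vec ?d (\<lambda>i. F v (e i)) = (\<Sum>j\<in>J. P j * F v j)" for v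
      by (rule dot)
  qed
qed

section \<open>Strong products and disjoint unions\<close>

lemma finite_pverts_strong_product:
  "finite (pverts G) \<Longrightarrow> finite (pverts H) \<Longrightarrow> finite (pverts (strong_product G H))"
  by (simp add: strong_product_def)

lemma finite_pverts_disjoint_union:
  "finite (pverts G) \<Longrightarrow> finite (pverts H) \<Longrightarrow> finite (pverts (disjoint_union G H))"
  by (simp add: disjoint_union_def)

text \<open>Distinct diagonal vertices could be adjacent only along an arc common to both
  graphs.\<close>

lemma card_le_independence_number_strong_product:
  assumes "finite (pverts G)" "pverts H = pverts G" "parcs G \<inter> parcs H = {}"
  shows "card (pverts G) \<le> independence_number (strong_product G H)"
proof -
  have "independent_set (strong_product G H) ((\<lambda>v. (v, v)) ` pverts G)"
    using assms(2,3) by (auto simp: independent_set_def strong_product_def adj_or_eq_def)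
  from card_le_independence_number[OF finite_pverts_strong_product this]
  show ?thesis
    using assms by (simp add: card_image inj_on_def)
qed

lemma adj_or_eq_disjoint_union:
  "adj_or_eq (disjoint_union G H) (Inl a) (Inl b) \<longleftrightarrow> adj_or_eq G a b"
  "adj_or_eq (disjoint_union G H) (Inr c) (Inr d) \<longleftrightarrow> adj_or_eq H c d"
  "\<not> adj_or_eq (disjoint_union G H) (Inl a) (Inr c)"
  "\<not> adj_or_eq (disjoint_union G H) (Inr c) (Inl a)"
  by (auto simp: adj_or_eq_def disjoint_union_def)

text \<open>The square of the disjoint union falls into four parts without arcs between them: the
  two squares and the mixed products in both orders. An optimal set \<open>R\<close> of the product
  is used twice, once in each order.\<close>

lemma independence_number_disjoint_union_square:
  fixes G :: "'a pair_pre_digraph" and H :: "'b pair_pre_digraph"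
  assumes fin: "finite (pverts G)" "finite (pverts H)"
  shows "(independence_number G)\<^sup>2 + (independence_number H)\<^sup>2
           + 2 * independence_number (strong_product G H)
         \<le> independence_number (strong_power (disjoint_union G H) 2)"
proof -
  obtain S where S: "independent_set G S" "card S = independence_number G"
    using independence_number_attained fin by blast
  obtain T where T: "independent_set H T" "card T = independence_number H"
    using independence_number_attained fin by blast
  obtain R where R: "independent_set (strong_product G H) R"
    "card R = independence_number (strong_product G H)"
    using independence_number_attained finite_pverts_strong_product fin by blast
  have sub: "S \<subseteq> pverts G" "T \<subseteq> pverts H" "R \<subseteq> pverts G \<times> pverts H"
    using S T R by (auto simp: independent_set_def strong_product_def)
  then have finSTR: "finite S" "finite T" "finite R"
    using fin finite_subset by (blast intro: finite_cartesian_product)+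
  have nadjS: "a = b" if "a \<in> S" "b \<in> S" "adj_or_eq G a b" for a b
    using that S by (auto simp: independent_set_def adj_or_eq_def)
  have nadjT: "a = b" if "a \<in> T" "b \<in> T" "adj_or_eq H a b" for a b
    using that T by (auto simp: independent_set_def adj_or_eq_def)
  have nadjR: "a = b \<and> c = d" if "(a, c) \<in> R" "(b, d) \<in> R" "adj_or_eq G a b" "adj_or_eq H c d"
    for a b c d
  proof -
    have "((a, c), (b, d)) \<notin> parcs (strong_product G H)"
      using that R(1) by (simp add: independent_set_def)
    then show ?thesis
      using that sub(3) by (auto simp: strong_product_def)
  qed
  define A1 :: "('a + 'b) list set" where "A1 = (\<lambda>(a, b). [Inl a, Inl b]) ` (S \<times> S)"
  define A2 :: "('a + 'b) list set" where "A2 = (\<lambda>(a, b). [Inr a, Inr b]) ` (T \<times> T)"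
  define A3 :: "('a + 'b) list set" where "A3 = (\<lambda>(a, b). [Inl a, Inr b]) ` R"
  define A4 :: "('a + 'b) list set" where "A4 = (\<lambda>(a, b). [Inr b, Inl a]) ` R"
  note A_defs = A1_def A2_def A3_def A4_def
  have "card A1 = (card S)\<^sup>2" "card A2 = (card T)\<^sup>2" "card A3 = card R" "card A4 = card R"
    unfolding A_defs
    by (subst card_image; force simp: inj_on_def card_cartesian_product power2_eq_square)+
  moreover have "finite A1" "finite A2" "finite A3" "finite A4"
    using finSTR by (auto simp: A_defs)
  moreover have "A1 \<inter> A2 = {}" "(A1 \<union> A2) \<inter> A3 = {}" "(A1 \<union> A2 \<union> A3) \<inter> A4 = {}"
    by (auto simp: A_defs)
  ultimately have card: "card (A1 \<union> A2 \<union> A3 \<union> A4) = (card S)\<^sup>2 + (card T)\<^sup>2 + 2 * card R"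
    by (simp add: card_Un_disjoint)
  have "independent_set (strong_power (disjoint_union G H) 2) (A1 \<union> A2 \<union> A3 \<union> A4)"
    unfolding independent_set_strong_power_iff
  proof (intro conjI ballI impI)
    fix us assume "us \<in> A1 \<union> A2 \<union> A3 \<union> A4"
    then show "length us = 2" "set us \<subseteq> pverts (disjoint_union G H)"
      using sub by (auto simp: A_defs disjoint_union_def)
  next
    fix us vs assume "us \<in> A1 \<union> A2 \<union> A3 \<union> A4" "vs \<in> A1 \<union> A2 \<union> A3 \<union> A4" "us \<noteq> vs"
    then show "\<not> list_all2 (adj_or_eq (disjoint_union G H)) us vs"
      unfolding A_defs
      by (elim UnE imageE; clarsimp simp: adj_or_eq_disjoint_union; metis nadjS nadjT nadjR)
  qed
  from card_le_independence_number[OF finite_pverts_strong_power[OF finite_pverts_disjoint_union[OF fin]] this]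
  show ?thesis
    using card S T R by simp
qed

text \<open>A gain in the strong product makes the two mixed parts exceed the term 2ab of (a + b)^2;
  the square root of the second power then bounds the capacity from below.\<close>

lemma shannon_capacity_disjoint_union_gt:
  assumes fin: "finite (pverts G)" "finite (pverts H)" and ne: "pverts G \<noteq> {}"
    and gt: "independence_number (strong_product G H) > independence_number G * independence_number H"
  shows "shannon_capacity (disjoint_union G H) > real (independence_number G) + real (independence_number H)"
proof -
  let ?a = "independence_number G" and ?b = "independence_number H"
  let ?N = "independence_number (strong_power (disjoint_union G H) 2)"
  have "(?a + ?b)\<^sup>2 < ?N"
    using independence_number_disjoint_union_square[OF fin] gt
    by (simp add: power2_eq_square algebra_simps)
  then have "(real ?a + real ?b)\<^sup>2 < real ?N"
    by (metis of_nat_add of_nat_less_iff of_nat_power)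
  then have "real ?a + real ?b < sqrt (real ?N)"
    by (rule real_less_rsqrt)
  also have "\<dots> \<le> shannon_capacity (disjoint_union G H)"
    using root_independence_number_le_shannon_capacity[OF finite_pverts_disjoint_union[OF fin], of 2] ne
    by (simp add: sqrt_def disjoint_union_def)
  finally show ?thesis .
qed

section \<open>The symplectic graphs on 63 vertices\<close>

text \<open>
  Adding an eighth point to each of these sets gives representatives of the nonzero even subsets
  of an 8-element set modulo complement, that is, the points of \<open>PG(5, 2)\<close>. Two points are
  orthogonal for the symplectic form iff the original sets have odd intersection.
\<close>

definition odd_sets :: "nat set set" where
  "odd_sets = {A. A \<subseteq> {..<7} \<and> card A \<in> {1, 3, 5}}"

text \<open>Coding the sets by \<open>set_encode\<close> makes the vertices natural numbers.
  \<open>P = odd\<close> gives G1 and \<open>P = even\<close> gives G2.\<close>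

definition overlap_graph :: "(nat \<Rightarrow> bool) \<Rightarrow> nat pair_pre_digraph" where
  "overlap_graph P =
     \<lparr> pverts = set_encode ` odd_sets,
       parcs = {(u, v). u \<in> set_encode ` odd_sets \<and> v \<in> set_encode ` odd_sets \<and> u \<noteq> v \<and>
                  P (card (set_decode u \<inter> set_decode v))} \<rparr>"

lemma finite_odd_sets: "finite odd_sets"
  by (rule finite_subset[of _ "Pow {..<7}"]) (auto simp: odd_sets_def)

lemma odd_setsD:
  assumes "A \<in> odd_sets"
  shows "finite A" "A \<subseteq> {..<7}" "odd (card A)"
  using assms finite_subset[of A "{..<7}"] by (auto simp: odd_sets_def)

text \<open>The whole set corresponds to the zero vector. Splitting it off turns sums over all 64
  odd subsets, where cancellation is exact, into sums over \<open>odd_sets\<close>.\<close>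

lemma odd_sets_insert_full:
  "{A. A \<subseteq> {..<7} \<and> odd (card A)} = insert {..<7} odd_sets" "{..<7} \<notin> odd_sets"
proof -
  have "A = {..<7} \<or> card A \<in> {1, 3, 5}" if "A \<subseteq> {..<7::nat}" "odd (card A)" for A
  proof (cases "card A = 7")
    case True
    then show ?thesis
      using card_subset_eq[of "{..<7::nat}" A] that by simp
  next
    case False
    have "card A \<le> 7"
      using card_mono[of "{..<7::nat}" A] that by simp
    then have "card A \<in> {..7}"
      by simp
    also have "{..7::nat} = {0, 1, 2, 3, 4, 5, 6, 7}"
      by auto
    finally show ?thesis
      using that False by auto
  qed
  then show "{A. A \<subseteq> {..<7} \<and> odd (card A)} = insert {..<7} odd_sets"
    by (auto simp: odd_sets_def)
  show "{..<7} \<notin> odd_sets"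
    by (simp add: odd_sets_def)
qed

lemma card_odd_sets: "card odd_sets = 63"
proof -
  have "odd_sets = (\<Union>k\<in>{1, 3, 5}. {A. A \<subseteq> {..<7} \<and> card A = k})"
    by (auto simp: odd_sets_def)
  also have "card \<dots> = (\<Sum>k\<in>{1, 3, 5}. card {A. A \<subseteq> {..<7::nat} \<and> card A = k})"
    by (rule card_UN_disjoint) auto
  also have "\<dots> = (\<Sum>k\<in>{1, 3, 5}. 7 choose k)"
    by (simp add: n_subsets)
  also have "\<dots> = 63"
    by (simp add: numeral_eq_Suc)
  finally show ?thesis .
qed

section \<open>Character sums over the odd sets\<close>

definition toggle :: "'a \<Rightarrow> 'a set \<Rightarrow> 'a set" where
  "toggle a A = (if a \<in> A then A - {a} else insert a A)"

lemma mem_toggle_iff: "x \<in> toggle a A \<longleftrightarrow> (x \<in> A) \<noteq> (x = a)"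
  by (auto simp: toggle_def)

lemma even_card_toggle: "finite A \<Longrightarrow> even (card (toggle a A)) \<longleftrightarrow> odd (card A)"
  using card_gt_0_iff[of A] by (auto simp: toggle_def)

text \<open>Toggling one point inside \<open>z\<close> and one outside is an involution that
  preserves the parity of \<open>A\<close> and flips that of \<open>A \<inter> z\<close>, so the
  terms cancel in pairs.\<close>

lemma sum_character_odd_subsets:
  assumes "finite U" "z \<subseteq> U" "z \<noteq> {}" "z \<noteq> U"
  shows "(\<Sum>A | A \<subseteq> U \<and> odd (card A). (-1) ^ card (A \<inter> z)) = (0 :: real)"
proof -
  obtain a b where ab: "a \<in> z" "a \<in> U" "b \<in> U" "b \<notin> z"
    using assms by blast
  define t where "t A = toggle a (toggle b A)" for A
  let ?X = "{A. A \<subseteq> U \<and> odd (card A)}"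
  have fin: "finite A" if "A \<subseteq> U" for A
    using that assms(1) finite_subset by blast
  have sub: "toggle x A \<subseteq> U" if "A \<subseteq> U" "x \<in> U" for x A
    using that by (auto simp: toggle_def)
  have t_t: "t (t A) = A" for A
    unfolding t_def set_eq_iff mem_toggle_iff by auto
  have t_X: "t A \<in> ?X" if "A \<in> ?X" for A
    using that ab by (simp add: t_def sub fin even_card_toggle)
  have sign: "(-1) ^ card (t A \<inter> z) = - ((-1) ^ card (A \<inter> z) :: real)" if "A \<in> ?X" for A
  proof -
    have "t A \<inter> z = toggle a (A \<inter> z)"
      unfolding t_def set_eq_iff mem_toggle_iff Int_iff using ab by auto
    moreover have "finite (A \<inter> z)"
      using that fin by blast
    ultimately have "even (card (t A \<inter> z)) \<longleftrightarrow> odd (card (A \<inter> z))"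
      by (simp add: even_card_toggle)
    then show ?thesis
      by (cases "even (card (A \<inter> z))") auto
  qed
  have "(\<Sum>A\<in>?X. (-1) ^ card (A \<inter> z) :: real) = (\<Sum>A\<in>?X. (-1) ^ card (t A \<inter> z))"
    by (rule sum.reindex_bij_witness[of _ t t]) (use t_t t_X in auto)
  also have "\<dots> = - (\<Sum>A\<in>?X. (-1) ^ card (A \<inter> z))"
    by (simp add: sign sum_negf)
  finally show ?thesis by simp
qed

text \<open>For odd sets, \<open>(1 + character v u) / 2\<close> is the entry of the adjacency
  matrix of \<open>overlap_graph even\<close>, including the zero diagonal.\<close>

definition character :: "nat set \<Rightarrow> nat set \<Rightarrow> real" where
  "character v u = (-1) ^ card (u \<inter> v)"

lemma sum_character_odd_sets:
  assumes "z \<subseteq> {..<7}" "z \<noteq> {}" "z \<noteq> {..<7}"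
  shows "(\<Sum>u\<in>odd_sets. character z u) = - ((-1) ^ card z)"
proof -
  have "character z {..<7} + (\<Sum>u\<in>odd_sets. character z u) = 0"
    using sum_character_odd_subsets[of "{..<7}" z] assms finite_odd_sets odd_sets_insert_full
    by (simp add: character_def)
  moreover have "{..<7} \<inter> z = z"
    using assms by blast
  ultimately show ?thesis
    by (simp add: character_def)
qed

lemma sum_character:
  assumes "v \<in> odd_sets"
  shows "(\<Sum>u\<in>odd_sets. character v u) = 1"
  using assms odd_setsD[OF assms] odd_sets_insert_full(2)
  by (subst sum_character_odd_sets) auto

lemma even_card_symmetric_difference:
  assumes "finite A" "finite B"
  shows "even (card ((A - B) \<union> (B - A))) \<longleftrightarrow> even (card A + card B)"
proof -
  have "card ((A - B) \<union> (B - A)) = card (A - B) + card (B - A)"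
    using assms by (intro card_Un_disjoint) auto
  moreover have "card A = card (A - B) + card (A \<inter> B)"
    using assms by (metis Int_Diff_Un Int_Diff_disjoint add.commute card_Un_disjoint finite_Diff finite_Int)
  moreover have "card B = card (B - A) + card (A \<inter> B)"
    using assms by (metis Int_Diff_Un Int_Diff_disjoint Int_commute add.commute card_Un_disjoint finite_Diff finite_Int)
  ultimately show ?thesis by presburger
qed

text \<open>The product of two characters is the character of the symmetric difference of
  \<open>v\<close> and \<open>w\<close>. That set has even size, hence is not the whole set, and it
  is nonempty when \<open>v\<close> and \<open>w\<close> differ.\<close>

lemma sum_character_mult:
  assumes v: "v \<in> odd_sets" and w: "w \<in> odd_sets"
  shows "(\<Sum>u\<in>odd_sets. character v u * character w u) = (if v = w then 63 else -1)"
proof (cases "v = w")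
  case True
  then show ?thesis
    by (simp add: character_def card_odd_sets flip: power_add)
next
  case False
  define z where "z = (v - w) \<union> (w - v)"
  have even: "even (card z)"
    unfolding z_def using odd_setsD[OF v] odd_setsD[OF w]
    by (subst even_card_symmetric_difference) auto
  have z: "z \<subseteq> {..<7}" "z \<noteq> {}" "z \<noteq> {..<7}"
    using odd_setsD[OF v] odd_setsD[OF w] False even by (auto simp: z_def)
  have "character v u * character w u = character z u" if "u \<in> odd_sets" for u
  proof -
    have "u \<inter> z = (u \<inter> v - u \<inter> w) \<union> (u \<inter> w - u \<inter> v)"
      by (auto simp: z_def)
    then have "even (card (u \<inter> z)) \<longleftrightarrow> even (card (u \<inter> v) + card (u \<inter> w))"
      using even_card_symmetric_difference[of "u \<inter> v" "u \<inter> w"] odd_setsD(1)[OF that] by simp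
    then show ?thesis
      unfolding character_def by (simp add: minus_one_power_iff flip: power_add)
  qed
  then have "(\<Sum>u\<in>odd_sets. character v u * character w u) = (\<Sum>u\<in>odd_sets. character z u)"
    by simp
  also have "\<dots> = -1"
    using sum_character_odd_sets[OF z] even by simp
  finally show ?thesis
    using False by simp
qed

text \<open>
  The adjacency matrix \<open>A\<close> of \<^term>\<open>overlap_graph even\<close> has eigenvalues 32, 4, \<open>-4\<close>, so
  \<open>K = I + A / 4\<close> has eigenvalues 9, 2, 0 and \<open>K - J / 7\<close> (\<open>J\<close> the all-ones matrix) is twice a
  projection. Its columns are \<open>centered_label\<close>; scaled by \<open>1 / sqrt 2\<close> and shifted along the
  all-ones vector they have Gram matrix \<open>K\<close>.
\<close>

definition centered_label :: "nat set \<Rightarrow> nat set \<Rightarrow> real" where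
  "centered_label v u = of_bool (u = v) + character v u / 8 - 1 / 56"

definition odd_set_label :: "nat set \<Rightarrow> nat set \<Rightarrow> real" where
  "odd_set_label v u = 1 / 21 + centered_label v u / sqrt 2"

text \<open>The all-ones vector has eigenvalue 9 = 63 / 7 under K, so subtracting J / 7 kills it.
  The constant 1 / 56 is 1 / 7 - 1 / 8, where 1 / 8 comes from (1 + character) / 8.\<close>

lemma sum_centered_label:
  assumes "v \<in> odd_sets"
  shows "(\<Sum>u\<in>odd_sets. centered_label v u) = 0"
proof -
  have "(\<Sum>u\<in>odd_sets. centered_label v u) =
      (\<Sum>u\<in>odd_sets. of_bool (u = v)) + (\<Sum>u\<in>odd_sets. character v u) / 8
      - (\<Sum>u\<in>odd_sets. 1 / 56)"
    unfolding centered_label_def sum_divide_distrib sum.distrib sum_subtractf ..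
  also have "(\<Sum>u\<in>odd_sets. of_bool (u = v)) = (1 :: real)"
    using assms finite_odd_sets by (simp add: of_bool_def)
  finally show ?thesis
    using assms by (simp add: sum_character card_odd_sets)
qed

text \<open>This is (K - J / 7)^2 = 2 (K - J / 7) entrywise: the value is twice
  \<open>centered_label v w\<close>, as the matrix is symmetric.\<close>

lemma sum_centered_label_mult:
  assumes v: "v \<in> odd_sets" and w: "w \<in> odd_sets"
  shows "(\<Sum>u\<in>odd_sets. centered_label v u * centered_label w u) =
           (if v = w then 12 / 7 else (character v w - 1 / 7) / 4)"
proof -
  have delta: "(\<Sum>u\<in>odd_sets. of_bool (u = x) * g u) = g x" if "x \<in> odd_sets"
    for x and g :: "nat set \<Rightarrow> real"
  proof -
    have "(\<Sum>u\<in>odd_sets. of_bool (u = x) * g u) = (\<Sum>u\<in>odd_sets. if u = x then g u else 0)"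
      by (intro sum.cong) auto
    then show ?thesis
      using that finite_odd_sets by simp
  qed
  \<comment> \<open>The label of \<open>w\<close> is expanded only where it multiplies the character
    of \<open>v\<close>; against the constant -1 / 56 it stays whole and sums to zero.\<close>
  have "(\<Sum>u\<in>odd_sets. centered_label v u * centered_label w u) =
      (\<Sum>u\<in>odd_sets. of_bool (u = v) * centered_label w u)
      + (\<Sum>u\<in>odd_sets. of_bool (u = w) * character v u) / 8
      + (\<Sum>u\<in>odd_sets. character v u * character w u) / 64
      - (\<Sum>u\<in>odd_sets. character v u) / 448
      - (\<Sum>u\<in>odd_sets. centered_label w u) / 56"
    unfolding sum_divide_distrib sum.distrib[symmetric] sum_subtractf[symmetric]
    by (intro sum.cong refl) (simp add: centered_label_def field_simps)
  also have "\<dots> = centered_label w v + character v w / 8 + (if v = w then 63 else -1) / 64 - 1 / 448"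
    using v w by (simp add: delta sum_character_mult sum_character sum_centered_label)
  also have "character w v = character v w"
    by (simp add: character_def Int_commute)
  then have "centered_label w v = of_bool (v = w) + character v w / 8 - 1 / 56"
    by (simp add: centered_label_def)
  also have "of_bool (v = w) + character v w / 8 - 1 / 56 + character v w / 8
      + (if v = w then 63 else -1) / 64 - 1 / 448
      = (if v = w then 12 / 7 else (character v w - 1 / 7) / 4)"
    using odd_setsD(3)[OF v] by (auto simp: character_def field_simps)
  finally show ?thesis .
qed

text \<open>The constant parts contribute 63 / 21^2 = 1 / 7, which restores J / 7; the mixed terms
  vanish because centered labels sum to zero, and the factor \<open>1 / sqrt 2\<close> turns 2 (K -
  J / 7) into K - J / 7.\<close>

lemma sum_odd_set_label_mult:
  assumes v: "v \<in> odd_sets" and w: "w \<in> odd_sets"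
  shows "(\<Sum>u\<in>odd_sets. odd_set_label v u * odd_set_label w u) =
           (if v = w then 1 else (1 + character v w) / 8)"
proof -
  define r where "r = 1 / sqrt 2"
  have label: "odd_set_label x u = 1 / 21 + r * centered_label x u" for x u
    by (simp add: odd_set_label_def r_def)
  have "odd_set_label v u * odd_set_label w u = 1 / 441 + r * centered_label v u / 21
      + r * centered_label w u / 21 + (r * r) * (centered_label v u * centered_label w u)" for u
    by (simp add: label algebra_simps)
  moreover have "r * r = 1 / 2"
    by (simp add: r_def)
  ultimately have "odd_set_label v u * odd_set_label w u = 1 / 441 + r * centered_label v u / 21
      + r * centered_label w u / 21 + centered_label v u * centered_label w u / 2" for u
    by simp
  then have "(\<Sum>u\<in>odd_sets. odd_set_label v u * odd_set_label w u) =
      1 / 7 + (\<Sum>u\<in>odd_sets. centered_label v u * centered_label w u) / 2"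
    using sum_centered_label[OF v] sum_centered_label[OF w]
    by (simp add: sum.distrib card_odd_sets flip: sum_divide_distrib sum_distrib_left)
  then show ?thesis
    using sum_centered_label_mult[OF v w] by (cases "v = w") (simp_all add: field_simps)
qed

section \<open>Vertices, arcs and independent sets of the overlap graphs\<close>

lemma pverts_overlap_graph: "pverts (overlap_graph P) = set_encode ` odd_sets"
  by (simp add: overlap_graph_def)

lemma set_decode_in_odd_sets:
  "v \<in> pverts (overlap_graph P) \<Longrightarrow> set_decode v \<in> odd_sets"
  using odd_setsD(1) by (auto simp: pverts_overlap_graph)

lemma finite_pverts_overlap_graph: "finite (pverts (overlap_graph P))"
  using finite_odd_sets by (simp add: pverts_overlap_graph)

lemma card_set_encode_image:
  assumes "F \<subseteq> odd_sets"
  shows "card (set_encode ` F) = card F"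
  by (rule card_image, rule inj_on_subset[OF inj_on_set_encode])
    (use assms odd_setsD(1) in blast)

lemma parcs_overlap_graph_iff:
  assumes "A \<in> odd_sets" "B \<in> odd_sets"
  shows "(set_encode A, set_encode B) \<in> parcs (overlap_graph P) \<longleftrightarrow> A \<noteq> B \<and> P (card (A \<inter> B))"
  using assms odd_setsD(1) by (auto simp: overlap_graph_def set_encode_eq)

lemma simple_graph_overlap_graph:
  assumes "\<And>A. A \<in> odd_sets \<Longrightarrow> \<exists>B\<in>odd_sets. B \<noteq> A \<and> P (card (A \<inter> B))"
  shows "simple_graph (overlap_graph P)"
  unfolding simple_graph_def
proof
  show "pair_graph (overlap_graph P)"
  proof
    show "symmetric (with_proj (overlap_graph P))"
      by (auto simp: symmetric_def arcs_ends_def overlap_graph_def arc_to_ends_def sym_def Int_commute)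
    show "finite (parcs (overlap_graph P))"
      by (rule finite_subset[of _ "set_encode ` odd_sets \<times> set_encode ` odd_sets"])
        (use finite_odd_sets in \<open>auto simp: overlap_graph_def\<close>)
  qed (use finite_odd_sets in \<open>auto simp: overlap_graph_def\<close>)
  show "\<forall>v\<in>pverts (overlap_graph P). \<exists>u. (v, u) \<in> parcs (overlap_graph P)"
  proof
    fix v assume "v \<in> pverts (overlap_graph P)"
    then obtain A where A: "A \<in> odd_sets" "v = set_encode A"
      by (auto simp: pverts_overlap_graph)
    then obtain B where "B \<in> odd_sets" "B \<noteq> A" "P (card (A \<inter> B))"
      using assms by blast
    then show "\<exists>u. (v, u) \<in> parcs (overlap_graph P)"
      using A parcs_overlap_graph_iff by blast
  qed
qed

lemma card_le_independence_number_overlap_graph: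
  assumes "F \<subseteq> odd_sets" "\<And>A B. A \<in> F \<Longrightarrow> B \<in> F \<Longrightarrow> A \<noteq> B \<Longrightarrow> \<not> P (card (A \<inter> B))"
  shows "card F \<le> independence_number (overlap_graph P)"
proof -
  have "independent_set (overlap_graph P) (set_encode ` F)"
    unfolding independent_set_def pverts_overlap_graph
    using assms(2) by (auto simp: parcs_overlap_graph_iff subsetD[OF assms(1)])
  from card_le_independence_number[OF finite_pverts_overlap_graph this]
  show ?thesis
    using card_set_encode_image[OF assms(1)] by simp
qed

section \<open>Parameters of the two graphs\<close>

lemma odd_overlap_graph:
  shows "simple_graph (overlap_graph odd)" "independence_number (overlap_graph odd) = 7"
    "shannon_capacity (overlap_graph odd) = 7"
proof -
  show "simple_graph (overlap_graph odd)"
  proof (rule simple_graph_overlap_graph)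
    fix A assume A: "A \<in> odd_sets"
    have "A \<noteq> {}"
      using odd_setsD[OF A] by auto
    then obtain a where a: "a \<in> A" "a < 7"
      using odd_setsD[OF A] by blast
    show "\<exists>B\<in>odd_sets. B \<noteq> A \<and> odd (card (A \<inter> B))"
    proof (cases "A = {a}")
      case True
      \<comment> \<open>A singleton needs a larger odd set through its point: three cyclically
        consecutive residues do.\<close>
      define B where "B = {a, (a + 1) mod 7, (a + 2) mod 7}"
      have "a \<in> {0, 1, 2, 3, 4, 5, 6}"
        using a by auto
      then have "card B = 3"
        by (auto simp: B_def)
      then have "B \<in> odd_sets" "B \<noteq> A"
        using a True by (auto simp: odd_sets_def B_def)
      moreover have "A \<inter> B = {a}"
        using True by (auto simp: B_def)
      ultimately show ?thesis by force
    next
      case False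
      then show ?thesis
        using a by (intro bexI[of _ "{a}"]) (auto simp: odd_sets_def)
    qed
  qed
  let ?F = "(\<lambda>i. {i}) ` {..<7::nat}"
  have "card ?F \<le> independence_number (overlap_graph odd)"
    by (rule card_le_independence_number_overlap_graph)
      (auto simp: odd_sets_def Int_insert_left split: if_splits)
  then have lower: "7 \<le> independence_number (overlap_graph odd)"
    by (simp add: card_image)
  \<comment> \<open>Each vertex is represented by its own set; distinct non-adjacent vertices meet
    evenly, as the parity bound requires.\<close>
  have "independence_number (strong_power (overlap_graph odd) n) \<le> card {..<7::nat} ^ n" for n
  proof (rule independence_number_strong_power_le_parity)
    show "even (card (set_decode u \<inter> set_decode v))"
      if "u \<in> pverts (overlap_graph odd)" "v \<in> pverts (overlap_graph odd)" "u \<noteq> v"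
        "(u, v) \<notin> parcs (overlap_graph odd)" for u v
      using that by (simp add: overlap_graph_def)
  qed (use finite_pverts_overlap_graph odd_setsD[OF set_decode_in_odd_sets] in simp_all)
  then have upper: "independence_number (strong_power (overlap_graph odd) n) \<le> 7 ^ n" for n
    by simp
  show "independence_number (overlap_graph odd) = 7" "shannon_capacity (overlap_graph odd) = 7"
    using shannon_capacity_eqI[OF finite_pverts_overlap_graph lower upper] by simp_all
qed

text \<open>One labeling of value 7 bounds both the independence numbers of all strong powers and
  the Lovasz number, and the seven Fano lines meet this bound.\<close>

lemma even_overlap_graph:
  shows "simple_graph (overlap_graph even)" "independence_number (overlap_graph even) = 7"
    "shannon_capacity (overlap_graph even) = 7" "lovasz_number (overlap_graph even) = ereal 7"
proof -
  let ?G = "overlap_graph even"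
  have fin: "finite (pverts ?G)"
    by (rule finite_pverts_overlap_graph)
  have card: "card (pverts ?G) = 63"
    by (simp add: pverts_overlap_graph card_set_encode_image card_odd_sets)
  then have ne: "pverts ?G \<noteq> {}"
    by force
  show "simple_graph ?G"
  proof (rule simple_graph_overlap_graph)
    fix A assume A: "A \<in> odd_sets"
    \<comment> \<open>The whole set would be isolated, as it meets every odd set oddly. Any other
      odd set misses a point b, and \<open>{b}\<close> is then a neighbour.\<close>
    have "A \<noteq> {..<7}"
      using A odd_sets_insert_full(2) by blast
    then obtain b where "b < 7" "b \<notin> A"
      using odd_setsD(2)[OF A] by blast
    then show "\<exists>B\<in>odd_sets. B \<noteq> A \<and> even (card (A \<inter> B))"
      by (intro bexI[of _ "{b}"]) (auto simp: odd_sets_def)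
  qed
  text \<open>The lines of the Fano plane pairwise meet in one point.\<close>
  define line where "line i = {i, (i + 1) mod 7, (i + 3) mod 7}" for i :: nat
  have seven: "{..<7} = {0, 1, 2, 3, 4, 5, 6 :: nat}"
    by auto
  have card_line: "\<forall>i\<in>{..<7}. card (line i) = 3"
    unfolding seven by (simp add: line_def)
  \<comment> \<open>\<open>{0, 1, 3}\<close> is a perfect difference set modulo 7: each nonzero
    residue is a difference exactly once, so distinct translates share one point.\<close>
  have meet: "\<forall>i\<in>{..<7}. \<forall>j\<in>{..<7}. i \<noteq> j \<longrightarrow> card (line i \<inter> line j) = 1"
    unfolding seven by (simp add: line_def)
  have "inj_on line {..<7}"
  proof (rule inj_onI)
    fix i j :: nat assume ij: "i \<in> {..<7}" "j \<in> {..<7}" "line i = line j"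
    then have "card (line i \<inter> line j) = 3"
      using card_line by simp
    then show "i = j"
      using meet ij by (metis numeral_eq_one_iff semiring_norm(86))
  qed
  moreover have "card (line ` {..<7}) \<le> independence_number ?G"
  proof (rule card_le_independence_number_overlap_graph)
    show "line ` {..<7} \<subseteq> odd_sets"
      using card_line by (auto simp: odd_sets_def) (auto simp: line_def)
    show "\<not> even (card (A \<inter> B))" if AB: "A \<in> line ` {..<7}" "B \<in> line ` {..<7}" "A \<noteq> B" for A B
    proof -
      obtain i j where "i \<in> {..<7}" "j \<in> {..<7}" "A = line i" "B = line j"
        using AB by blast
      moreover from this have "i \<noteq> j"
        using AB by blast
      ultimately have "card (A \<inter> B) = 1"
        using meet by simp
      then show ?thesis by simp
    qed
  qed
  ultimately have lower: "7 \<le> independence_number ?G"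
    by (simp add: card_image)
  \<comment> \<open>The normalized all-ones vector, whose overlap with every label is the
    same.\<close>
  let ?P = "\<lambda>_. 1 / sqrt 63"
  obtain \<Psi> \<psi> where label: "unit_vec_in (card (pverts ?G)) \<Psi>" "orthonormal_labeling ?G \<psi>"
    and dot: "\<And>v. \<Psi> \<bullet> \<psi> v = (\<Sum>u\<in>odd_sets. ?P u * odd_set_label (set_decode v) u)"
  proof (rule labeling_of_functions)
    show "(\<Sum>u\<in>odd_sets. ?P u * ?P u) = 1"
      by (simp add: card_odd_sets)
    show "(\<Sum>u\<in>odd_sets. odd_set_label (set_decode v) u * odd_set_label (set_decode v) u) = 1"
      if "v \<in> pverts ?G" for v
      using set_decode_in_odd_sets[OF that] by (simp add: sum_odd_set_label_mult)
    show "(\<Sum>u\<in>odd_sets. odd_set_label (set_decode v) u * odd_set_label (set_decode w) u) = 0"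
      if "v \<in> pverts ?G" "w \<in> pverts ?G" "v \<noteq> w" "(v, w) \<notin> parcs ?G" for v w
    proof -
      have "set_decode v \<noteq> set_decode w"
        using that(3) by (metis set_decode_inverse)
      \<comment> \<open>An odd intersection makes the character -1, so the Gram entry (1 +
        character) / 8 is zero.\<close>
      moreover have "odd (card (set_decode w \<inter> set_decode v))"
        using that by (simp add: overlap_graph_def Int_commute)
      ultimately show ?thesis
        using that(1,2)[THEN set_decode_in_odd_sets]
        by (simp add: sum_odd_set_label_mult character_def)
    qed
  qed (simp_all add: finite_odd_sets card card_odd_sets)
  have dot_ge: "1 / 7 \<le> (\<Psi> \<bullet> \<psi> v)\<^sup>2" if "v \<in> pverts ?G" for v
  proof -
    \<comment> \<open>Only the constant part 63 / 21 survives, and (3 / \<open>sqrt 63\<close>)^2 =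
      1 / 7.\<close>
    have "(\<Sum>u\<in>odd_sets. odd_set_label (set_decode v) u) = 3"
      using sum_centered_label[OF set_decode_in_odd_sets[OF that]]
      by (simp add: odd_set_label_def sum.distrib card_odd_sets flip: sum_divide_distrib)
    then have "\<Psi> \<bullet> \<psi> v = 3 / sqrt 63"
      unfolding dot by (simp flip: sum_divide_distrib)
    then show ?thesis
      by (simp add: power_divide)
  qed
  have "real (independence_number (strong_power ?G n)) \<le> 7 ^ n" for n
    using independence_number_strong_power_le_labeling[OF fin label _ dot_ge] by simp
  then have upper: "independence_number (strong_power ?G n) \<le> 7 ^ n" for n
    by (metis of_nat_le_iff of_nat_numeral of_nat_power)
  show \<alpha>: "independence_number ?G = 7" and "shannon_capacity ?G = 7"
    using shannon_capacity_eqI[OF fin lower upper] by simp_all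
  show "lovasz_number ?G = ereal 7"
    using lovasz_number_le[OF fin ne label _ dot_ge] independence_number_le_lovasz_number[OF fin ne]
    by (simp add: \<alpha> antisym)
qed

theorem theoremB0p6:
  shows "\<exists>(G1 :: nat pair_pre_digraph) (G2 :: nat pair_pre_digraph).
    simple_graph G1 \<and> simple_graph G2 \<and>
    single_shot G1 \<and> single_shot G2 \<and>
    shannon_capacity (strong_product G1 G2) > shannon_capacity G1 * shannon_capacity G2 \<and>
    shannon_capacity (disjoint_union G1 G2) > shannon_capacity G1 + shannon_capacity G2 \<and>
    ereal (real (independence_number G2)) = lovasz_number G2"
proof (intro exI conjI)
  let ?G = "overlap_graph odd" and ?H = "overlap_graph even"
  note [simp] = odd_overlap_graph even_overlap_graph
  have fin: "finite (pverts ?G)" "finite (pverts ?H)"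
    by (rule finite_pverts_overlap_graph)+
  have card: "card (pverts ?G) = 63"
    by (simp add: pverts_overlap_graph card_set_encode_image card_odd_sets)
  then have ne: "pverts ?G \<noteq> {}" "pverts ?H \<noteq> {}"
    by (force simp: pverts_overlap_graph)+
  have "parcs ?G \<inter> parcs ?H = {}"
    by (auto simp: overlap_graph_def)
  then have product: "63 \<le> independence_number (strong_product ?G ?H)"
    using card_le_independence_number_strong_product[OF fin(1), of ?H] card
    by (simp add: pverts_overlap_graph)
  show "simple_graph ?G" "simple_graph ?H" "single_shot ?G" "single_shot ?H"
    "ereal (real (independence_number ?H)) = lovasz_number ?H"
    by (simp_all add: single_shot_def)
  have "pverts (strong_product ?G ?H) \<noteq> {}"
    using ne by (simp add: strong_product_def)
  \<comment> \<open>The capacity is at least the independence number, and 63 > 7 * 7.\<close>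
  then show "shannon_capacity (strong_product ?G ?H) > shannon_capacity ?G * shannon_capacity ?H"
    using independence_number_le_shannon_capacity[OF finite_pverts_strong_product[OF fin]] product
    by simp
  show "shannon_capacity (disjoint_union ?G ?H) > shannon_capacity ?G + shannon_capacity ?H"
    using shannon_capacity_disjoint_union_gt[OF fin ne(1)] product by simp
qed

end
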